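(* Let $\mathbf X$ be an $\alpha$-Hölder rough path over $\mathbb R^d$ on $[0,T]$ and $\mathbf Z=(Z,Z')\in\mathcal D^\alpha_{\mathbf X}([0,T];\mathbb R^m)$, and for each $[u,v]\subset[0,T]$ and $a\in\mathcal A=\{1,\dots,m\}$ let $\mathcal Z^{(a)}_{u,v}\in\mathbb R^{q\times q}$ and $\zeta^{(a)}_{u,v}\in\mathbb R^q$ be the coefficients of a controlled Runge-Kutta method. For $p=3$, the tree matching condition $$a_{u,v}(\tau)=Z^\tau_{u,v},\qquad\tau\in\mathcal T_{\le3},\quad0\le u\le v\le T,$$ is equivalent to the following identities holding for every $0\le u\le v\le T$ and every $a,b,c\in\mathcal A$: $$\sum_{i=1}^q(\zeta^{(a)}_{u,v})_i=Z^{\bullet_a}_{u,v},\qquad\sum_{i,j=1}^q(\zeta^{(a)}_{u,v})_i(\mathcal Z^{(b)}_{u,v})_{i,j}=Z^{[\bullet_b]_a}_{u,v},$$ $$\sum_{i,j,k=1}^q(\zeta^{(a)}_{u,v})_i(\mathcal Z^{(b)}_{u,v})_{i,j}(\mathcal Z^{(c)}_{u,v})_{j,k}=Z^{[[\bullet_c]_b]_a}_{u,v},$$ $$\sum_{i=1}^q(\zeta^{(a)}_{u,v})_i\Bigl(\sum_{j=1}^q(\mathcal Z^{(b)}_{u,v})_{i,j}\Bigr)\Bigl(\sum_{k=1}^q(\mathcal Z^{(c)}_{u,v})_{i,k}\Bigr)=Z^{[\bullet_b\bullet_c]_a}_{u,v}.$$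
   Context: Fix $\alpha\in(1/3,1/2]$, $T>0$ and $d,m,q\in\mathbb N=\{1,2,\dots\}$. Write $X_{s,t}:=X_t-X_s$. Rough and controlled paths. An $\alpha$-Hölder rough path over $\mathbb R^d$ is a pair $\mathbf X=(X,\mathbb X)$ with $X\in C^\alpha([0,T];\mathbb R^d)$ and $\mathbb X:\{0\le s\le t\le T\}\to\mathbb R^{d\times d}$ with $\sup_{s<t}|\mathbb X_{s,t}|/|t-s|^{2\alpha}<\infty$ and $\mathbb X_{s,t}=\mathbb X_{s,u}+\mathbb X_{u,t}+X_{s,u}\otimes X_{u,t}$. $\mathcal D^\alpha_{\mathbf X}([0,T];V)$ is the set of pairs $(Y,Y')$ ($\mathbf X$-controlled rough paths) with $Y\in C^\alpha([0,T];V)$, $Y'\in C^\alpha([0,T];\mathcal L(\mathbb R^d,V))$ (Gubinelli derivative) and $R^Y_{s,t}:=Y_{s,t}-Y'_sX_{s,t}$ satisfying $\sup_{s<t}|R^Y_{s,t}|/|t-s|^{2\alpha}<\infty$. Controlled rough integral: for controlled $(H,H')$ and $(W,W')$ with values in $\mathcal L(\mathbb R^k,V)$ and $\mathbb R^k$, $\int_s^tH_r\,d\mathbf W_r:=\lim_{|P|\to0}\sum_{[u,v]\in P}(H_uW_{u,v}+(H'_u\diamond W'_u)\mathbb X_{u,v})$ over partitions $P$ of $[s,t]$ (the limit exists), where $(A\diamond B)(x\otimes\tilde x):=A(x)(B\tilde x)$. Trees. $\mathcal T$ is the set of (nonplanar) rooted trees with vertices decorated by $\mathcal A$; $\mathbf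 1$ is the empty tree/forest. $[\tau_1\cdots\tau_n]_a$ is the tree obtained by joining the roots of $\tau_1,\dots,\tau_n$ to a new root decorated by $a$; $\bullet_a=[\mathbf 1]_a$ is the one-vertex tree. $|\tau|$ is the number of vertices; $\mathcal T_{\le3}=\{\tau\in\mathcal T:|\tau|\le3\}$. Controlled coefficients. For fixed $s$ and $t\in[s,T]$: $Z^{\mathbf 1}_{s,t}:=1$; for forests $Z^{\tau_1\cdots\tau_n}_{s,t}:=\prod_jZ^{\tau_j}_{s,t}$; $Z^{[\eta]_a}_{s,t}:=\int_s^tZ^\eta_{s,u}\,d\mathbf Z^a_u$ (controlled rough integral), with Gubinelli derivatives $(Z^{\mathbf 1}_{s,\cdot})'=0$, $(Z^{\tau_1\cdots\tau_n}_{s,\cdot})'_r=\sum_j(Z^{\tau_j}_{s,\cdot})'_r\prod_{i\ne j}Z^{\tau_i}_{s,r}$, $(Z^{[\eta]_a}_{s,\cdot})'_r=Z^\eta_{s,r}(Z^a)'_r$. Numerical tree coefficients of the method. With $\odot$ the componentwise product on $\mathbb R^q$ and $\mathbf 1_q=(1,\dots,1)^\top$ (the empty product): $\Phi_{u,v}(\mathbf 1)=\mathbf 1_q$, $a_{u,v}(\mathbf 1)=1$, and for $\tau=[\tau_1\cdots\tau_n]_a$, $\Phi_{u,v}(\tau)=\mathcal Z^{(a)}_{u,v}(\Phi_{u,v}(\tau_1)\odot\cdots\odot\Phi_{u,v}(\tau_n))$ and $a_{u,v}(\tau)=\langle\zeta^{(a)}_{u,v},\Phi_{u,v}(\tau_1)\odot\cdots\odot\Phi_{u,v}(\tau_n)\rangle_{\mathbb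 R^q}$, with $\Phi_{u,v}(\bullet_a)=\mathcal Z^{(a)}_{u,v}\mathbf 1_q$, $a_{u,v}(\bullet_a)=\langle\zeta^{(a)}_{u,v},\mathbf 1_q\rangle$. *)

theory Defs
  imports "HOL-Analysis.Analysis" "HOL-Library.Multiset"
begin

section \<open>Rough paths and controlled paths\<close>

definition holder_path :: "real \<Rightarrow> real \<Rightarrow> (real \<Rightarrow> 'v::real_normed_vector) \<Rightarrow> bool" where
  "holder_path \<alpha> T Y \<longleftrightarrow>
     (\<exists>C. \<forall>s\<in>{0..T}. \<forall>t\<in>{0..T}. norm (Y t - Y s) \<le> C * \<bar>t - s\<bar> powr \<alpha>)"

definition tensor :: "real ^ 'd \<Rightarrow> real ^ 'd \<Rightarrow> real ^ 'd ^ 'd" where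
  "tensor x y = (\<chi> i j. x $ i * y $ j)"

text \<open>Two-parameter functions are total on the reals; only their values on
  \<open>0 \<le> s \<le> t \<le> T\<close> are constrained or used.\<close>

definition rough_path ::
  "real \<Rightarrow> real \<Rightarrow> (real \<Rightarrow> real ^ 'd) \<Rightarrow> (real \<Rightarrow> real \<Rightarrow> real ^ 'd ^ 'd) \<Rightarrow> bool" where
  "rough_path \<alpha> T X XX \<longleftrightarrow>
     holder_path \<alpha> T X \<and>
     (\<exists>C. \<forall>s t. 0 \<le> s \<and> s < t \<and> t \<le> T \<longrightarrow>
        norm (XX s t) \<le> C * (t - s) powr (2 * \<alpha>)) \<and>
     (\<forall>s u t. 0 \<le> s \<and> s \<le> u \<and> u \<le> t \<and> t \<le> T \<longrightarrow>
        XX s t = XX s u + XX u t + tensor (X u - X s) (X t - X u))"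

definition controlled_path ::
  "real \<Rightarrow> real \<Rightarrow> (real \<Rightarrow> real ^ 'd) \<Rightarrow> (real \<Rightarrow> 'v::real_normed_vector) \<Rightarrow>
   (real \<Rightarrow> (real ^ 'd) \<Rightarrow>\<^sub>L 'v) \<Rightarrow> bool" where
  "controlled_path \<alpha> T X Y Y' \<longleftrightarrow>
     holder_path \<alpha> T Y \<and> holder_path \<alpha> T Y' \<and>
     (\<exists>C. \<forall>s t. 0 \<le> s \<and> s < t \<and> t \<le> T \<longrightarrow>
        norm (Y t - Y s - Y' s (X t - X s)) \<le> C * (t - s) powr (2 * \<alpha>))"

section \<open>The controlled rough integral\<close>

text \<open>\<open>diamond A B\<close> is the linear map on \<open>d \<times> d\<close> matrices with
  \<open>x \<otimes> y \<mapsto> A x (B y)\<close>, written out on the standard basis of the tensor product;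
  see the lemma \<open>diamond_tensor\<close>.\<close>

definition diamond ::
  "((real ^ 'd) \<Rightarrow>\<^sub>L ('w::real_normed_vector \<Rightarrow>\<^sub>L 'v::real_normed_vector)) \<Rightarrow>
   ((real ^ 'd) \<Rightarrow>\<^sub>L 'w) \<Rightarrow> real ^ 'd ^ 'd \<Rightarrow> 'v" where
  "diamond A B M =
     (\<Sum>i\<in>UNIV. \<Sum>j\<in>UNIV. M $ i $ j *\<^sub>R blinfun_apply (A (axis i 1)) (B (axis j 1)))"

lemma diamond_tensor: "diamond A B (tensor x y) = blinfun_apply (A x) (B y)"
proof -
  have x: "x = (\<Sum>i\<in>UNIV. x $ i *\<^sub>R axis i 1)"
    using basis_expansion[of x] by (simp add: scalar_mult_eq_scaleR)
  have y: "y = (\<Sum>i\<in>UNIV. y $ i *\<^sub>R axis i 1)"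
    using basis_expansion[of y] by (simp add: scalar_mult_eq_scaleR)
  have "blinfun_apply (A x) (B y) =
      blinfun_apply (A (\<Sum>i\<in>UNIV. x $ i *\<^sub>R axis i 1)) (B (\<Sum>j\<in>UNIV. y $ j *\<^sub>R axis j 1))"
    using x y by simp
  also have "\<dots> = diamond A B (tensor x y)"
    unfolding diamond_def
    by (subst sum.swap) (simp add: tensor_def blinfun.sum_left blinfun.sum_right
        blinfun.scaleR_left blinfun.scaleR_right scaleR_sum_right mult.commute)
  finally show ?thesis by simp
qed

text \<open>A partition of \<open>[s,t]\<close> is the strictly increasing list of its points, from \<open>s\<close> to \<open>t\<close>;
  for \<open>s = t\<close> it is \<open>[s]\<close> and has no intervals.\<close>

definition partition_of :: "real \<Rightarrow> real \<Rightarrow> real list \<Rightarrow> bool" where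
  "partition_of s t P \<longleftrightarrow> P \<noteq> [] \<and> hd P = s \<and> last P = t \<and> sorted_wrt (<) P"

definition mesh_less :: "real \<Rightarrow> real list \<Rightarrow> bool" where
  "mesh_less \<delta> P \<longleftrightarrow> (\<forall>i < length P - 1. P ! Suc i - P ! i < \<delta>)"

definition mesh_filter :: "real \<Rightarrow> real \<Rightarrow> real list filter" where
  "mesh_filter s t = (INF \<delta>\<in>{0<..}. principal {P. partition_of s t P \<and> mesh_less \<delta> P})"

lemma mesh_filter_neq_bot:
  assumes "s \<le> t"
  shows "mesh_filter s t \<noteq> bot"
proof -
  have ex: "\<exists>P. partition_of s t P \<and> mesh_less \<delta> P" if "0 < \<delta>" for \<delta>
  proof (cases "s = t")
    case True
    then have "partition_of s t [s] \<and> mesh_less \<delta> [s]"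
      by (simp add: partition_of_def mesh_less_def)
    then show ?thesis by blast
  next
    case False
    with assms have st: "s < t" by simp
    obtain n :: nat where n: "(t - s) / \<delta> < real n"
      using reals_Archimedean2 by blast
    have "0 < (t - s) / \<delta>" using st that by simp
    with n have n0: "0 < n" by (metis less_trans of_nat_0_less_iff)
    define h where "h = (t - s) / real n"
    have h: "0 < h" "h < \<delta>"
      using n n0 st that by (auto simp: h_def field_simps)
    define P where "P = map (\<lambda>i. s + real i * h) [0..<Suc n]"
    have "hd P = s" by (simp add: P_def hd_map del: upt_Suc)
    moreover have "last P = t" using n0 by (simp add: P_def h_def)
    moreover have "sorted_wrt (<) P"
      using h by (auto simp: P_def sorted_wrt_iff_nth_less simp del: upt_Suc)
    moreover have "mesh_less \<delta> P"
      using h by (auto simp: mesh_less_def P_def algebra_simps simp del: upt_Suc)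
    ultimately show ?thesis
      by (auto simp: partition_of_def P_def intro!: exI[of _ P])
  qed
  have mono: "mesh_less \<delta>' P" if "mesh_less \<delta> P" "\<delta> \<le> \<delta>'" for \<delta> \<delta>' P
    using that by (force simp: mesh_less_def)
  show ?thesis
    unfolding mesh_filter_def
  proof (subst INF_filter_bot_base)
    fix a b :: real
    assume "a \<in> {0<..}" "b \<in> {0<..}"
    then show "\<exists>k\<in>{0<..}. principal {P. partition_of s t P \<and> mesh_less k P}
        \<le> inf (principal {P. partition_of s t P \<and> mesh_less a P})
             (principal {P. partition_of s t P \<and> mesh_less b P})"
      by (intro bexI[of _ "min a b"]) (auto intro: mono)
  next
    show "\<not> (\<exists>\<delta>\<in>{0<..}. principal {P. partition_of s t P \<and> mesh_less \<delta> P} = bot)"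
      using ex by (auto simp: principal_eq_bot_iff)
  qed
qed

definition partition_sum :: "(real \<Rightarrow> real \<Rightarrow> 'v::comm_monoid_add) \<Rightarrow> real list \<Rightarrow> 'v" where
  "partition_sum \<Xi> P = (\<Sum>i < length P - 1. \<Xi> (P ! i) (P ! Suc i))"

definition rough_integral ::
  "(real \<Rightarrow> real \<Rightarrow> real ^ 'd ^ 'd) \<Rightarrow>
   (real \<Rightarrow> 'w::real_normed_vector \<Rightarrow>\<^sub>L 'v::real_normed_vector) \<Rightarrow>
   (real \<Rightarrow> (real ^ 'd) \<Rightarrow>\<^sub>L ('w \<Rightarrow>\<^sub>L 'v)) \<Rightarrow>
   (real \<Rightarrow> 'w) \<Rightarrow> (real \<Rightarrow> (real ^ 'd) \<Rightarrow>\<^sub>L 'w) \<Rightarrow> real \<Rightarrow> real \<Rightarrow> 'v" where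
  "rough_integral XX H H' W W' s t =
     Lim (mesh_filter s t)
       (partition_sum (\<lambda>u v. H u (W v - W u) + diamond (H' u) (W' u) (XX u v)))"

text \<open>Real-valued integrand and integrator: a real number acts on the line by multiplication.\<close>

definition rough_integral_real ::
  "(real \<Rightarrow> real \<Rightarrow> real ^ 'd ^ 'd) \<Rightarrow>
   (real \<Rightarrow> real) \<Rightarrow> (real \<Rightarrow> (real ^ 'd) \<Rightarrow>\<^sub>L real) \<Rightarrow>
   (real \<Rightarrow> real) \<Rightarrow> (real \<Rightarrow> (real ^ 'd) \<Rightarrow>\<^sub>L real) \<Rightarrow> real \<Rightarrow> real \<Rightarrow> real" where
  "rough_integral_real XX h h' W W' s t =
     rough_integral XX (\<lambda>u. blinfun_mult_right (h u))
       (\<lambda>u. Blinfun blinfun_mult_right o\<^sub>L h' u) W W' s t"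

lemma rough_integral_real_eq:
  "rough_integral_real XX h h' W W' s t =
     Lim (mesh_filter s t) (partition_sum (\<lambda>u v. h u * (W v - W u) +
       (\<Sum>i\<in>UNIV. \<Sum>j\<in>UNIV. XX u v $ i $ j * (h' u (axis i 1) * W' u (axis j 1)))))"
  by (simp add: rough_integral_real_def rough_integral_def diamond_def
      bounded_linear_Blinfun_apply bounded_linear_blinfun_mult_right)

section \<open>Decorated rooted trees\<close>

text \<open>\<open>Node a {#\<tau>\<^sub>1, \<dots>, \<tau>\<^sub>n#}\<close> is \<open>[\<tau>\<^sub>1 \<cdots> \<tau>\<^sub>n]\<^sub>a\<close>. The children form a multiset, so
  the trees are nonplanar. \<open>node_tree\<close> consists of the nonempty trees; a forest is a multiset of
  them. In \<open>'a tree\<close> the empty tree \<open>\<one>\<close> is \<open>None\<close>.\<close>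

datatype 'a node_tree = Node 'a "'a node_tree multiset"

type_synonym 'a tree = "'a node_tree option"

abbreviation leaf :: "'a \<Rightarrow> 'a node_tree" where
  "leaf a \<equiv> Node a {#}"

primrec node_vertices :: "'a node_tree \<Rightarrow> nat" where
  "node_vertices (Node a ts) = Suc (\<Sum>n\<in>#image_mset node_vertices ts. n)"

definition vertices :: "'a tree \<Rightarrow> nat" where
  "vertices \<tau> = (case \<tau> of None \<Rightarrow> 0 | Some t \<Rightarrow> node_vertices t)"

definition trees_upto :: "nat \<Rightarrow> 'a tree set" where
  "trees_upto n = {\<tau>. vertices \<tau> \<le> n}"

section \<open>Controlled coefficients\<close>

text \<open>A pair \<open>(y, y')\<close> below is a real-valued path with its Gubinelli derivative. A multiset of
  such pairs, one for each tree of a forest, gives the product path and the derivative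
  of the product.\<close>

definition forest_path :: "((real \<Rightarrow> real) \<times> (real \<Rightarrow> 'b)) multiset \<Rightarrow> real \<Rightarrow> real" where
  "forest_path P r = (\<Prod>p\<in>#P. fst p r)"

definition forest_deriv ::
  "((real \<Rightarrow> real) \<times> (real \<Rightarrow> 'b::real_vector)) multiset \<Rightarrow> real \<Rightarrow> 'b" where
  "forest_deriv P r = (\<Sum>p\<in>#P. (\<Prod>p'\<in>#P - {#p#}. fst p' r) *\<^sub>R snd p r)"

definition comp_path :: "(real \<Rightarrow> real ^ 'm) \<Rightarrow> 'm \<Rightarrow> real \<Rightarrow> real" where
  "comp_path Z a t = Z t $ a"

definition comp_deriv ::
  "(real \<Rightarrow> (real ^ 'd) \<Rightarrow>\<^sub>L (real ^ 'm)) \<Rightarrow> 'm \<Rightarrow> real \<Rightarrow> (real ^ 'd) \<Rightarrow>\<^sub>L real" where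
  "comp_deriv Z' a t = blinfun_inner_left (axis a 1) o\<^sub>L Z' t"

lemma comp_deriv_apply: "comp_deriv Z' a t x = Z' t x $ a"
  by (simp add: comp_deriv_def inner_axis)

text \<open>\<open>node_coeff XX Z Z' s \<tau>\<close> is the pair of \<open>t \<mapsto> Z\<^sup>\<tau>\<^bsub>s,t\<^esub>\<close> and its Gubinelli derivative.\<close>

primrec node_coeff ::
  "(real \<Rightarrow> real \<Rightarrow> real ^ 'd ^ 'd) \<Rightarrow> (real \<Rightarrow> real ^ 'm) \<Rightarrow>
   (real \<Rightarrow> (real ^ 'd) \<Rightarrow>\<^sub>L (real ^ 'm)) \<Rightarrow> real \<Rightarrow> 'm node_tree \<Rightarrow>
   (real \<Rightarrow> real) \<times> (real \<Rightarrow> (real ^ 'd) \<Rightarrow>\<^sub>L real)" where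
  "node_coeff XX Z Z' s (Node a ts) =
     (let P = image_mset (node_coeff XX Z Z' s) ts in
      (\<lambda>t. rough_integral_real XX (forest_path P) (forest_deriv P)
             (comp_path Z a) (comp_deriv Z' a) s t,
       \<lambda>r. forest_path P r *\<^sub>R comp_deriv Z' a r))"

definition tree_coeff ::
  "(real \<Rightarrow> real \<Rightarrow> real ^ 'd ^ 'd) \<Rightarrow> (real \<Rightarrow> real ^ 'm) \<Rightarrow>
   (real \<Rightarrow> (real ^ 'd) \<Rightarrow>\<^sub>L (real ^ 'm)) \<Rightarrow> 'm tree \<Rightarrow> real \<Rightarrow> real \<Rightarrow> real" where
  "tree_coeff XX Z Z' \<tau> s t =
     (case \<tau> of None \<Rightarrow> 1 | Some \<sigma> \<Rightarrow> fst (node_coeff XX Z Z' s \<sigma>) t)"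

section \<open>Numerical tree coefficients\<close>

text \<open>Multiplication on \<open>real ^ 'q\<close> is componentwise and its unit is the all-ones vector, so
  \<open>prod_mset\<close> is the iterated product \<open>\<odot>\<close> and gives \<open>(1, \<dots>, 1)\<close> on the empty forest.
  \<open>A a u v\<close> and \<open>\<zeta> a u v\<close> are the matrix and the weight vector of the method on \<open>[u,v]\<close>.\<close>

primrec stage_coeff ::
  "('m \<Rightarrow> real \<Rightarrow> real \<Rightarrow> real ^ 'q ^ 'q) \<Rightarrow> real \<Rightarrow> real \<Rightarrow> 'm node_tree \<Rightarrow> real ^ 'q" where
  "stage_coeff A u v (Node a ts) = A a u v *v prod_mset (image_mset (stage_coeff A u v) ts)"

primrec node_weight ::
  "('m \<Rightarrow> real \<Rightarrow> real \<Rightarrow> real ^ 'q ^ 'q) \<Rightarrow> ('m \<Rightarrow> real \<Rightarrow> real \<Rightarrow> real ^ 'q) \<Rightarrow>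
   real \<Rightarrow> real \<Rightarrow> 'm node_tree \<Rightarrow> real" where
  "node_weight A \<zeta> u v (Node a ts) =
     \<zeta> a u v \<bullet> prod_mset (image_mset (stage_coeff A u v) ts)"

definition tree_weight ::
  "('m \<Rightarrow> real \<Rightarrow> real \<Rightarrow> real ^ 'q ^ 'q) \<Rightarrow> ('m \<Rightarrow> real \<Rightarrow> real \<Rightarrow> real ^ 'q) \<Rightarrow>
   'm tree \<Rightarrow> real \<Rightarrow> real \<Rightarrow> real" where
  "tree_weight A \<zeta> \<tau> u v = (case \<tau> of None \<Rightarrow> 1 | Some \<sigma> \<Rightarrow> node_weight A \<zeta> u v \<sigma>)"

end

theory Submission
  imports Defs
begin

text \<open>
  Both sides of the equivalence state, for every interval, that the numerical coefficient of a
  tree equals its controlled coefficient; they differ only in how the trees are listed and in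
  how the numerical coefficient is written. The proof is therefore combinatorial.

  Deleting the root of a tree with at most three vertices leaves a forest with at most two
  vertices, and this forest is empty, a single vertex, a chain of two vertices, or two single
  vertices. So up to decorations there are exactly four nonempty trees
  (\<open>tree_at_most_3_vertices_iff\<close>), the empty one being matched because both its coefficients
  are \<open>1\<close>. For each of the four shapes, expanding the inner product and the matrix-vector products
  over the standard basis turns the numerical coefficient into the stated sum
  (the lemmas \<open>node_weight_\<dots>\<close>).
\<close>

lemma node_vertices_pos: "0 < node_vertices t"
  by (cases t) simp

lemma tree_at_most_1_vertex_iff: "node_vertices t \<le> 1 \<longleftrightarrow> (\<exists>a. t = leaf a)"
proof (cases t)
  case (Node a ts)
  show ?thesis
  proof (cases ts)
    case (add x us)
    then show ?thesis
      using node_vertices_pos[of x] by (simp add: Node)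
  qed (simp add: Node)
qed

lemma tree_at_most_2_vertices_iff:
  "node_vertices t \<le> 2 \<longleftrightarrow> (\<exists>a. t = leaf a) \<or> (\<exists>a b. t = Node a {#leaf b#})"
proof
  assume le: "node_vertices t \<le> 2"
  obtain a ts where t: "t = Node a ts"
    by (cases t)
  show "(\<exists>a. t = leaf a) \<or> (\<exists>a b. t = Node a {#leaf b#})"
  proof (cases ts)
    case empty
    then show ?thesis by (simp add: t)
  next
    case x: (add x us)
    have "us = {#}"
    proof (cases us)
      case (add y vs)
      then show ?thesis
        using le node_vertices_pos[of x] node_vertices_pos[of y] by (simp add: t x)
    qed simp
    moreover have "node_vertices x \<le> 1"
      using le by (simp add: t x)
    ultimately show ?thesis
      unfolding tree_at_most_1_vertex_iff t x by blast
  qed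
qed auto

text \<open>Every child has at least one vertex, so a root leaves room for at most two children. An
  only child carries a tree with at most two vertices; of two children each is a single vertex.\<close>

lemma tree_at_most_3_vertices_iff:
  "node_vertices t \<le> 3 \<longleftrightarrow>
     (\<exists>a. t = leaf a) \<or> (\<exists>a b. t = Node a {#leaf b#}) \<or>
     (\<exists>a b c. t = Node a {#Node b {#leaf c#}#}) \<or> (\<exists>a b c. t = Node a {#leaf b, leaf c#})"
  (is "_ \<longleftrightarrow> ?shapes")
proof
  assume le: "node_vertices t \<le> 3"
  obtain a ts where t: "t = Node a ts"
    by (cases t)
  show ?shapes
  proof (cases ts)
    case empty
    then show ?thesis by (simp add: t)
  next
    case x: (add x us)
    show ?thesis
    proof (cases us)
      case empty
      then have "node_vertices x \<le> 2"
        using le by (simp add: t x)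
      then show ?thesis
        by (auto simp: t x empty tree_at_most_2_vertices_iff)
    next
      case y: (add y vs)
      have "vs = {#}"
      proof (cases vs)
        case (add z ws)
        then show ?thesis
          using le node_vertices_pos[of x] node_vertices_pos[of y] node_vertices_pos[of z]
          by (simp add: t x y)
      qed simp
      moreover have "node_vertices x \<le> 1" "node_vertices y \<le> 1"
        using le node_vertices_pos[of x] node_vertices_pos[of y] by (simp_all add: t x y)
      ultimately show ?thesis
        unfolding tree_at_most_1_vertex_iff t x y by blast
    qed
  qed
qed auto

lemma stage_coeff_leaf: "stage_coeff A u v (leaf a) $ i = (\<Sum>j\<in>UNIV. A a u v $ i $ j)"
  by (simp add: matrix_vector_mult_def)

lemma node_weight_leaf: "node_weight A \<zeta> u v (leaf a) = (\<Sum>i\<in>UNIV. \<zeta> a u v $ i)"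
  by (simp add: inner_vec_def)

lemma node_weight_chain_2:
  "node_weight A \<zeta> u v (Node a {#leaf b#}) =
     (\<Sum>i\<in>UNIV. \<Sum>j\<in>UNIV. \<zeta> a u v $ i * A b u v $ i $ j)"
  by (simp add: inner_vec_def matrix_vector_mult_def sum_distrib_left)

lemma node_weight_chain_3:
  "node_weight A \<zeta> u v (Node a {#Node b {#leaf c#}#}) =
     (\<Sum>i\<in>UNIV. \<Sum>j\<in>UNIV. \<Sum>k\<in>UNIV. \<zeta> a u v $ i * A b u v $ i $ j * A c u v $ j $ k)"
  by (simp add: inner_vec_def matrix_vector_mult_def sum_distrib_left mult.assoc)

lemma node_weight_cherry:
  "node_weight A \<zeta> u v (Node a {#leaf b, leaf c#}) =
     (\<Sum>i\<in>UNIV. \<zeta> a u v $ i * (\<Sum>j\<in>UNIV. A b u v $ i $ j) * (\<Sum>k\<in>UNIV. A c u v $ i $ k))"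
  by (simp add: inner_vec_def stage_coeff_leaf mult.assoc del: stage_coeff.simps)

text \<open>The classification of the trees, put into the form in which a condition on all of
  them splits into one condition per shape.\<close>

lemma ball_trees_upto_3_iff:
  "(\<forall>\<tau>\<in>trees_upto 3. Q \<tau>) \<longleftrightarrow>
     Q None \<and> (\<forall>a b c. Q (Some (leaf a)) \<and> Q (Some (Node a {#leaf b#})) \<and>
       Q (Some (Node a {#Node b {#leaf c#}#})) \<and> Q (Some (Node a {#leaf b, leaf c#})))"
proof -
  have "(\<forall>\<tau>\<in>trees_upto 3. Q \<tau>) \<longleftrightarrow> Q None \<and> (\<forall>t. node_vertices t \<le> 3 \<longrightarrow> Q (Some t))"
    by (simp add: trees_upto_def vertices_def split_option_all)
  then show ?thesis
    unfolding tree_at_most_3_vertices_iff by blast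
qed

theorem proposition4p9:
  fixes \<alpha> T :: real
    and X :: "real \<Rightarrow> real ^ 'd" and XX :: "real \<Rightarrow> real \<Rightarrow> real ^ 'd ^ 'd"
    and Z :: "real \<Rightarrow> real ^ 'm" and Z' :: "real \<Rightarrow> (real ^ 'd) \<Rightarrow>\<^sub>L (real ^ 'm)"
    and A :: "'m \<Rightarrow> real \<Rightarrow> real \<Rightarrow> real ^ 'q ^ 'q"
    and \<zeta> :: "'m \<Rightarrow> real \<Rightarrow> real \<Rightarrow> real ^ 'q"
  assumes "1/3 < \<alpha>" and "\<alpha> \<le> 1/2" and "0 < T"
    and "rough_path \<alpha> T X XX"
    and "controlled_path \<alpha> T X Z Z'"
  shows "(\<forall>\<tau>\<in>trees_upto 3. \<forall>u v. 0 \<le> u \<and> u \<le> v \<and> v \<le> T \<longrightarrow>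
            tree_weight A \<zeta> \<tau> u v = tree_coeff XX Z Z' \<tau> u v)
    \<longleftrightarrow>
    (\<forall>u v. 0 \<le> u \<and> u \<le> v \<and> v \<le> T \<longrightarrow> (\<forall>a b c.
       (\<Sum>i\<in>UNIV. \<zeta> a u v $ i) = tree_coeff XX Z Z' (Some (leaf a)) u v
     \<and> (\<Sum>i\<in>UNIV. \<Sum>j\<in>UNIV. \<zeta> a u v $ i * A b u v $ i $ j)
         = tree_coeff XX Z Z' (Some (Node a {#leaf b#})) u v
     \<and> (\<Sum>i\<in>UNIV. \<Sum>j\<in>UNIV. \<Sum>k\<in>UNIV. \<zeta> a u v $ i * A b u v $ i $ j * A c u v $ j $ k)
         = tree_coeff XX Z Z' (Some (Node a {#Node b {#leaf c#}#})) u v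
     \<and> (\<Sum>i\<in>UNIV. \<zeta> a u v $ i * (\<Sum>j\<in>UNIV. A b u v $ i $ j) * (\<Sum>k\<in>UNIV. A c u v $ i $ k))
         = tree_coeff XX Z Z' (Some (Node a {#leaf b, leaf c#})) u v))"
proof -
  have empty: "tree_weight A \<zeta> None u v = tree_coeff XX Z Z' None u v" for u v
    by (simp add: tree_weight_def tree_coeff_def)
  have weight: "tree_weight A \<zeta> (Some t) u v = node_weight A \<zeta> u v t" for t u v
    by (simp add: tree_weight_def)
  show ?thesis
    unfolding ball_trees_upto_3_iff weight node_weight_leaf node_weight_chain_2
      node_weight_chain_3 node_weight_cherry
    using empty by (intro iffI allI impI conjI) simp_all
qed

end
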